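(* Let $A:[0,\infty)\to\mathbb{R}^{d\times d}$ be continuous. If the zero solution of $\dot y(t)=A(t)y$, $y(0)=0$, is uniformly stable, then its $E(t)$ is linearly bounded; i.e., there is a constant $K>0$ such that $E(t)\le Kt$ for all $0\le t<\infty$.
   Context: Norms are Euclidean. Uniform stability of the zero solution of $\dot y=F(t,y)$ (with $F(t,0)\equiv0$): for every $\epsilon>0$ there exists $\delta>0$ such that for all $\tau\ge0$ and all $\eta$ with $\|\eta\|<\delta$, $\|y(t;\tau,\eta)\|<\epsilon$ for all $t\ge\tau$, where $y(t;s,\eta)$ denotes the solution of $\dot y=F(t,y)$ with $y(s)=\eta$. Here $F(t,y)=A(t)y$. Definition of $E$: let $\alpha:[0,\infty)\to[0,\infty)$ be any continuous strictly increasing function with $\alpha(0)=0$. For $h>0$ the family $\tilde Y_\alpha(h)$ of approximations to the zero solution consists of all functions $\tilde y(\cdot;h)$ obtained from sequences $v_1,v_2,\dots\in\mathbb{R}^d$ with $\|v_n\|\le 1$ by $\tilde y(0;h)=0$, $\tilde y(nh;h)=y(nh;(n-1)h,\tilde y((n-1)h;h))+h\alpha(h)v_n$ for $n\ge1$, and $\tilde y(t;h)=y(t;(n-1)h,\tilde y((n-1)h;h))$ for $(n-1)h\le t<nh$. Define $e_\alpha(t;h)=\sup_{\tilde y\in\tilde Y_\alpha(h)}\|\tilde y(t;h)\|$ and $E(t)=E_\alpha(t)=\limsup_{h\to0^+} e_\alpha(t;h)/\alpha(h)$; this value does not depend on the choice of $\alpha$. *)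

theory Defs
  imports "HOL-Analysis.Analysis"
begin

definition solves_on ::
  "(real \<Rightarrow> 'a \<Rightarrow> 'a) \<Rightarrow> real \<Rightarrow> real \<Rightarrow> 'a::real_normed_vector \<Rightarrow> (real \<Rightarrow> 'a) \<Rightarrow> bool"
  where "solves_on F s t \<eta> y \<longleftrightarrow>
    y s = \<eta> \<and> (\<forall>u\<in>{s..t}. (y has_vector_derivative F u (y u)) (at u within {s..t}))"

(* flow F t s \<eta> is y(t; s, \<eta>), for s \<le> t. It is meaningful when the initial value problem has a
   unique solution on [s, t], as it does for F u y = A u *v y with A continuous. *)
definition flow :: "(real \<Rightarrow> 'a \<Rightarrow> 'a) \<Rightarrow> real \<Rightarrow> real \<Rightarrow> 'a::real_normed_vector \<Rightarrow> 'a"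
  where "flow F t s \<eta> = (THE x. \<exists>y. solves_on F s t \<eta> y \<and> y t = x)"

definition uniformly_stable :: "(real \<Rightarrow> 'a::real_normed_vector \<Rightarrow> 'a) \<Rightarrow> bool"
  where "uniformly_stable F \<longleftrightarrow>
    (\<forall>\<epsilon>>0. \<exists>\<delta>>0. \<forall>\<tau>\<ge>0. \<forall>\<eta>. norm \<eta> < \<delta> \<longrightarrow> (\<forall>t\<ge>\<tau>. norm (flow F t \<tau> \<eta>) < \<epsilon>))"

(* Nonnegativity of \<alpha> on [0, \<infinity>) follows from monotonicity and \<alpha> 0 = 0. *)
definition gauge_fun :: "(real \<Rightarrow> real) \<Rightarrow> bool"
  where "gauge_fun \<alpha> \<longleftrightarrow> continuous_on {0..} \<alpha> \<and> strict_mono_on {0..} \<alpha> \<and> \<alpha> 0 = 0"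

(* Members are functions on [0, \<infinity>); their values at negative arguments are left arbitrary. *)
definition approximations ::
  "(real \<Rightarrow> 'a \<Rightarrow> 'a) \<Rightarrow> (real \<Rightarrow> real) \<Rightarrow> real \<Rightarrow> (real \<Rightarrow> 'a::real_normed_vector) set"
  where "approximations F \<alpha> h = {z. \<exists>v :: nat \<Rightarrow> 'a.
    (\<forall>n\<ge>1. norm (v n) \<le> 1) \<and>
    z 0 = 0 \<and>
    (\<forall>n\<ge>1. z (real n * h) =
       flow F (real n * h) ((real n - 1) * h) (z ((real n - 1) * h)) + (h * \<alpha> h) *\<^sub>R v n) \<and>
    (\<forall>n\<ge>1. \<forall>t. (real n - 1) * h \<le> t \<and> t < real n * h \<longrightarrow>
       z t = flow F t ((real n - 1) * h) (z ((real n - 1) * h)))}"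

(* Suprema and upper limits are taken in the extended reals, so that boundedness is not presupposed. *)
definition max_error ::
  "(real \<Rightarrow> 'a::real_normed_vector \<Rightarrow> 'a) \<Rightarrow> (real \<Rightarrow> real) \<Rightarrow> real \<Rightarrow> real \<Rightarrow> ereal"
  where "max_error F \<alpha> t h = (SUP z \<in> approximations F \<alpha> h. ereal (norm (z t)))"

definition error_growth ::
  "(real \<Rightarrow> 'a::real_normed_vector \<Rightarrow> 'a) \<Rightarrow> (real \<Rightarrow> real) \<Rightarrow> real \<Rightarrow> ereal"
  where "error_growth F \<alpha> t = Limsup (at_right 0) (\<lambda>h. max_error F \<alpha> t h / ereal (\<alpha> h))"

end

(* Variation of constants: the approximation error at time n h is the sum of n kicks of size
   h \<alpha>(h), each transported by the flow. For a linear equation, uniform stability bounds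
   the operator norms of all transition maps by one constant M, so the total error at time t is at
   most M n h \<alpha>(h) with n h \<le> t. *)
theory Submission
  imports Defs
begin

section \<open>Linear initial value problems\<close>

lemma bounded_bilinear_matrix_vector_mult:
  "bounded_bilinear ((*v) :: real ^ 'n ^ 'm \<Rightarrow> real ^ 'n \<Rightarrow> real ^ 'm)"
  unfolding bilinear_conv_bounded_bilinear[symmetric] bilinear_def
  by (auto intro!: linearI simp: matrix_vector_mult_add_rdistrib matrix_vector_right_distrib
      scaleR_matrix_vector_assoc matrix_vector_mult_scaleR)

lemma continuous_on_matrix_vector_mult:
  fixes A :: "'a::topological_space \<Rightarrow> real ^ 'n ^ 'm"
  assumes "continuous_on S A" "continuous_on S y"
  shows "continuous_on S (\<lambda>u. A u *v y u)"
  by (rule bounded_bilinear.continuous_on[OF bounded_bilinear_matrix_vector_mult assms])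

text \<open>The continuous image of a compact set is bounded, and the bilinear bound turns this into
  one Lipschitz constant for the right-hand side. It drives both the Gronwall and the Picard
  estimates.\<close>

lemma matrix_norm_bound_on_compact:
  fixes A :: "'a::topological_space \<Rightarrow> real ^ 'n ^ 'm"
  assumes "compact S" "continuous_on S A"
  obtains L where "L \<ge> 0" "\<And>u x. u \<in> S \<Longrightarrow> norm (A u *v x) \<le> L * norm x"
proof -
  obtain K where K: "K > 0" "\<And>(B :: real ^ 'n ^ 'm) x. norm (B *v x) \<le> norm B * norm x * K"
    using bounded_bilinear.pos_bounded[OF bounded_bilinear_matrix_vector_mult] by metis
  obtain C where C: "\<And>u. u \<in> S \<Longrightarrow> norm (A u) \<le> C"
    using compact_imp_bounded[OF compact_continuous_image[OF assms(2,1)]]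
    unfolding bounded_iff by blast
  show ?thesis
  proof (rule that[of "\<bar>C\<bar> * K"])
    fix u and x :: "real ^ 'n" assume "u \<in> S"
    then have "norm (A u) \<le> \<bar>C\<bar>"
      using C by force
    then have "norm (A u) * (norm x * K) \<le> \<bar>C\<bar> * (norm x * K)"
      using K(1) by (intro mult_right_mono) auto
    then show "norm (A u *v x) \<le> \<bar>C\<bar> * K * norm x"
      using K(2)[of "A u" x] by (simp add: mult_ac)
  qed (use K(1) in simp)
qed

section \<open>Uniqueness\<close>

text \<open>Applied to the difference of two solutions, this gives uniqueness and so makes the
  description in \<open>flow\<close> well determined.\<close>

lemma solves_on_linear_zero:
  fixes A :: "real \<Rightarrow> real ^ 'd ^ 'd"
  assumes cont: "continuous_on {s..t} A" and st: "s \<le> t"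
    and sol: "solves_on (\<lambda>u y. A u *v y) s t 0 y"
  shows "y t = 0"
proof -
  obtain L where L: "\<And>u x. u \<in> {s..t} \<Longrightarrow> norm (A u *v x) \<le> L * norm x"
    using matrix_norm_bound_on_compact[OF compact_Icc cont] by metis
  have y0: "y s = 0"
    and der: "\<And>u. u \<in> {s..t} \<Longrightarrow> (y has_vector_derivative A u *v y u) (at u within {s..t})"
    using sol by (auto simp: solves_on_def)
  \<comment> \<open>Gronwall: the weighted squared norm is nonincreasing.\<close>
  define f where "f = (\<lambda>u. exp (- (2 * L * u)) * (y u \<bullet> y u))"
  have conty: "continuous_on {s..t} y"
    using der has_vector_derivative_continuous continuous_on_eq_continuous_within by blast
  have "f t \<le> f s"
  proof (rule DERIV_nonpos_imp_decreasing_open[OF st])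
    show "continuous_on {s..t} f"
      unfolding f_def by (intro continuous_intros conty)
    fix u assume u: "s < u" "u < t"
    have "(y has_derivative (\<lambda>h. h *\<^sub>R (A u *v y u))) (at u)"
      using der[of u] u by (simp add: has_vector_derivative_def at_within_Icc_at)
    then have "((\<lambda>u. y u \<bullet> y u) has_derivative (\<lambda>h. h * (2 * (y u \<bullet> (A u *v y u))))) (at u)"
      by (auto intro!: derivative_eq_intros simp: inner_commute algebra_simps)
    then have "((\<lambda>u. y u \<bullet> y u) has_real_derivative 2 * (y u \<bullet> (A u *v y u))) (at u)"
      by (simp add: has_field_derivative_def mult.commute[of _ "2 * _"] mult_commute_abs)
    then have "(f has_real_derivative
        exp (- (2 * L * u)) * (2 * (y u \<bullet> (A u *v y u)) - 2 * L * (y u \<bullet> y u))) (at u)"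
      unfolding f_def by (auto intro!: derivative_eq_intros simp: algebra_simps)
    \<comment> \<open>By Cauchy-Schwarz the squared norm grows at rate at most \<open>2 * L\<close>,
      which is exactly the decay rate of the weight in \<open>f\<close>.\<close>
    moreover have "y u \<bullet> (A u *v y u) \<le> L * (y u \<bullet> y u)"
    proof -
      have "y u \<bullet> (A u *v y u) \<le> norm (y u) * norm (A u *v y u)"
        by (rule norm_cauchy_schwarz)
      also have "\<dots> \<le> norm (y u) * (L * norm (y u))"
        using u by (intro mult_left_mono L) auto
      finally show ?thesis
        by (simp add: dot_square_norm power2_eq_square mult_ac)
    qed
    ultimately show "\<exists>c. (f has_real_derivative c) (at u) \<and> c \<le> 0"
      by (intro exI conjI) (auto intro!: mult_nonneg_nonpos)
  qed
  \<comment> \<open>Here \<open>f s = 0\<close> because \<open>y s = 0\<close>, and the exponential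
    weight is positive.\<close>
  then have "y t \<bullet> y t \<le> 0"
    using y0 by (simp add: f_def mult_le_0_iff)
  then show ?thesis
    by (metis inner_gt_zero_iff not_less)
qed

section \<open>Existence by the Picard series\<close>

text \<open>These are the terms of the Peano-Baker series, that is, the differences of successive
  Picard iterates. With terms in place of iterates, the solution is a series that can be
  differentiated term by term.\<close>

fun picard_term :: "(real \<Rightarrow> real ^ 'd ^ 'd) \<Rightarrow> real \<Rightarrow> real ^ 'd \<Rightarrow> nat \<Rightarrow> real \<Rightarrow> real ^ 'd" where
  "picard_term A s \<eta> 0 u = \<eta>"
| "picard_term A s \<eta> (Suc n) u = integral {s..u} (\<lambda>w. A w *v picard_term A s \<eta> n w)"

lemma continuous_on_picard_term:
  assumes "continuous_on {s..t} A"
  shows "continuous_on {s..t} (picard_term A s \<eta> n)"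
proof (induction n)
  case (Suc n)
  then show ?case
    using assms by (auto intro!: indefinite_integral_continuous_1 integrable_continuous_real
        continuous_on_matrix_vector_mult)
qed simp

lemma has_vector_derivative_picard_term_Suc:
  assumes "continuous_on {s..t} A" "u \<in> {s..t}"
  shows "(picard_term A s \<eta> (Suc n) has_vector_derivative A u *v picard_term A s \<eta> n u)
    (at u within {s..t})"
  unfolding picard_term.simps[abs_def]
  using assms by (intro integral_has_vector_derivative continuous_on_matrix_vector_mult
      continuous_on_picard_term)

text \<open>Each integration multiplies by \<open>L\<close> and raises the power of
  \<open>u - s\<close>, producing the factorial. The bounds are the terms of an exponential series,
  hence summable.\<close>

lemma norm_picard_term_le:
  assumes cont: "continuous_on {s..t} A"
    and L: "L \<ge> 0" "\<And>u x. u \<in> {s..t} \<Longrightarrow> norm (A u *v x) \<le> L * norm x"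
    and u: "u \<in> {s..t}"
  shows "norm (picard_term A s \<eta> n u) \<le> norm \<eta> * ((L * (u - s)) ^ n / fact n)"
  using u
proof (induction n arbitrary: u)
  case (Suc n)
  let ?b = "\<lambda>n w. norm \<eta> * ((L * (w - s)) ^ n / fact n)"
  \<comment> \<open>The bound for \<open>Suc n\<close> is the antiderivative of \<open>L\<close>
    times the bound for \<open>n\<close> that vanishes at \<open>s\<close>.\<close>
  have "((\<lambda>w. L * ?b n w) has_integral ?b (Suc n) u - ?b (Suc n) s) {s..u}"
  proof (rule fundamental_theorem_of_calculus)
    fix x assume "x \<in> {s..u}"
    have "((\<lambda>w. (L * (w - s)) ^ Suc n) has_real_derivative real (Suc n) * (L * (x - s)) ^ n * L)
        (at x within {s..u})"
      by (auto intro!: derivative_eq_intros simp del: power_Suc)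
    from DERIV_cmult[OF DERIV_cdivide[OF this, of "fact (Suc n)"], of "norm \<eta>"]
    have "(?b (Suc n) has_real_derivative
        norm \<eta> * (real (Suc n) * (L * (x - s)) ^ n * L / fact (Suc n))) (at x within {s..u})" .
    also have "norm \<eta> * (real (Suc n) * (L * (x - s)) ^ n * L / fact (Suc n)) = L * ?b n x"
      by (subst fact_Suc) (simp add: divide_simps del: of_nat_Suc)
    finally have "(?b (Suc n) has_real_derivative L * ?b n x) (at x within {s..u})" .
    then show "(?b (Suc n) has_vector_derivative L * ?b n x) (at x within {s..u})"
      by (simp only: has_real_derivative_iff_has_vector_derivative)
  qed (use Suc.prems in simp)
  then have int: "((\<lambda>w. L * ?b n w) has_integral ?b (Suc n) u) {s..u}"
    by simp
  have "norm (integral {s..u} (\<lambda>w. A w *v picard_term A s \<eta> n w)) \<le> integral {s..u} (\<lambda>w. L * ?b n w)"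
  proof (rule integral_norm_bound_integral)
    have "continuous_on {s..t} (\<lambda>w. A w *v picard_term A s \<eta> n w)"
      by (intro continuous_on_matrix_vector_mult continuous_on_picard_term cont)
    then show "(\<lambda>w. A w *v picard_term A s \<eta> n w) integrable_on {s..u}"
      by (rule integrable_continuous_real[OF continuous_on_subset]) (use Suc.prems in auto)
    show "(\<lambda>w. L * ?b n w) integrable_on {s..u}"
      using int by blast
    fix w assume "w \<in> {s..u}"
    then have w: "w \<in> {s..t}"
      using Suc.prems by auto
    show "norm (A w *v picard_term A s \<eta> n w) \<le> L * ?b n w"
      by (rule order_trans[OF L(2)[OF w] mult_left_mono[OF Suc.IH[OF w] L(1)]])
  qed
  then show ?case
    using integral_unique[OF int] by simp
qed simp

text \<open>The Picard series converges uniformly together with its termwise derivatives, and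
  differentiating it reproduces \<open>A u\<close> applied to its sum.\<close>

lemma solves_on_linear_exists:
  fixes A :: "real \<Rightarrow> real ^ 'd ^ 'd"
  assumes cont: "continuous_on {s..t} A" and st: "s \<le> t"
  shows "\<exists>y. solves_on (\<lambda>u y. A u *v y) s t \<eta> y"
proof -
  obtain L where L: "L \<ge> 0" "\<And>u x. u \<in> {s..t} \<Longrightarrow> norm (A u *v x) \<le> L * norm x"
    using matrix_norm_bound_on_compact[OF compact_Icc cont] by metis
  let ?p = "picard_term A s \<eta>"
  \<comment> \<open>The term bound is taken at the right end \<open>t\<close>, where it is largest;
    this majorant is free of \<open>u\<close>, as the Weierstrass test requires.\<close>
  define b where "b n = norm \<eta> * ((L * (t - s)) ^ n / fact n)" for n
  have "summable (\<lambda>n. (L * (t - s)) ^ n / fact n)"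
    using summable_exp[of "L * (t - s)"] by (simp add: field_simps)
  then have sumb: "summable b"
    unfolding b_def by (rule summable_mult)
  then have sumLb: "summable (\<lambda>n. L * b n)"
    by (rule summable_mult)
  have pb: "norm (?p n u) \<le> b n" if u: "u \<in> {s..t}" for n u
  proof -
    have "(L * (u - s)) ^ n \<le> (L * (t - s)) ^ n"
      using u L(1) by (intro power_mono mult_left_mono) auto
    then show ?thesis
      unfolding b_def
      by (intro order_trans[OF norm_picard_term_le[OF cont L u]] mult_left_mono divide_right_mono) auto
  qed
  have psum: "summable (\<lambda>n. ?p n u)" if "u \<in> {s..t}" for u
    by (rule summable_comparison_test'[OF sumb, of 0]) (use pb that in auto)
  define S where "S u = (\<Sum>n. ?p n u)" for u
  have AS: "(\<Sum>n. A u *v ?p n u) = A u *v S u" if "u \<in> {s..t}" for u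
    using bounded_linear.suminf[OF matrix_vector_mul_bounded_linear psum[OF that], of "A u"]
    by (simp add: S_def)
  have unif: "uniform_limit {s..t} (\<lambda>n u. \<Sum>i<n. A u *v ?p i u) (\<lambda>u. \<Sum>i. A u *v ?p i u) sequentially"
  proof (rule Weierstrass_m_test[OF _ sumLb])
    show "norm (A u *v ?p n u) \<le> L * b n" if "u \<in> {s..t}" for n u
      by (rule order_trans[OF L(2)[OF that] mult_left_mono[OF pb[OF that] L(1)]])
  qed
  \<comment> \<open>The series is differentiated without its constant term \<eta>: the derivative of
    term \<open>Suc n\<close> is \<open>A u\<close> times term \<open>n\<close>, so the derivatives
    sum to \<open>A u *v S u\<close> for the full sum \<open>S\<close>. Adding \<eta> back to
    \<open>g\<close> recovers \<open>S\<close>.\<close>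
  have "\<exists>g. \<forall>u\<in>{s..t}. (\<lambda>n. ?p (Suc n) u) sums g u \<and>
      (g has_derivative (\<lambda>h. h *\<^sub>R (A u *v S u))) (at u within {s..t})"
  proof (rule has_derivative_series)
    show "(?p (Suc n) has_derivative (\<lambda>h. h *\<^sub>R (A u *v ?p n u))) (at u within {s..t})"
      if "u \<in> {s..t}" for n u
      using has_vector_derivative_picard_term_Suc[OF cont that, of \<eta> n]
      unfolding has_vector_derivative_def .
    \<comment> \<open>The derivatives must converge uniformly as linear maps in \<open>h\<close>.
      Each is \<open>h\<close> times a vector, so uniform convergence of the vectors
      suffices.\<close>
    fix e :: real assume "e > 0"
    have "\<forall>\<^sub>F n in sequentially. \<forall>u\<in>{s..t}. norm ((\<Sum>i<n. A u *v ?p i u) - A u *v S u) < e"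
      using uniform_limitD[OF unif \<open>e > 0\<close>] AS by (simp add: dist_norm)
    then show "\<forall>\<^sub>F n in sequentially. \<forall>u\<in>{s..t}. \<forall>h.
        norm ((\<Sum>i<n. h *\<^sub>R (A u *v ?p i u)) - h *\<^sub>R (A u *v S u)) \<le> e * norm h"
    proof eventually_elim
      case (elim n)
      show ?case
      proof (intro ballI allI)
        fix u h assume "u \<in> {s..t}"
        then have "norm ((\<Sum>i<n. A u *v ?p i u) - A u *v S u) \<le> e"
          using elim by (simp add: less_imp_le)
        then have "\<bar>h\<bar> * norm ((\<Sum>i<n. A u *v ?p i u) - A u *v S u) \<le> \<bar>h\<bar> * e"
          by (intro mult_left_mono) auto
        then show "norm ((\<Sum>i<n. h *\<^sub>R (A u *v ?p i u)) - h *\<^sub>R (A u *v S u)) \<le> e * norm h"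
          by (simp flip: scaleR_sum_right scaleR_diff_right add: mult.commute)
      qed
    qed
  next
    \<comment> \<open>Convergence at one point is required; at \<open>s\<close> every term is an
      integral over a one-point interval.\<close>
    show "(\<lambda>n. ?p (Suc n) s) sums 0"
      by simp
  qed (use st in auto)
  then obtain g where g: "\<And>u. u \<in> {s..t} \<Longrightarrow> (\<lambda>n. ?p (Suc n) u) sums g u"
      "\<And>u. u \<in> {s..t} \<Longrightarrow> (g has_derivative (\<lambda>h. h *\<^sub>R (A u *v S u))) (at u within {s..t})"
    by blast
  have gS: "S u = g u + \<eta>" if "u \<in> {s..t}" for u
    using sums_Suc[OF g(1)[OF that]] unfolding S_def by (simp add: sums_iff)
  have "g s = 0"
    using g(1)[of s] st sums_unique by fastforce
  moreover have "((\<lambda>u. g u + \<eta>) has_vector_derivative A u *v (g u + \<eta>)) (at u within {s..t})"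
    if "u \<in> {s..t}" for u
    using has_derivative_add_const[OF g(2)[OF that], of \<eta>] gS[OF that]
    by (simp add: has_vector_derivative_def)
  ultimately show ?thesis
    by (intro exI[of _ "\<lambda>u. g u + \<eta>"]) (auto simp: solves_on_def)
qed

section \<open>The flow of a linear equation\<close>

lemma solves_on_linear_add:
  fixes A :: "real \<Rightarrow> real ^ 'd ^ 'd"
  assumes "solves_on (\<lambda>u y. A u *v y) s t \<eta> y" "solves_on (\<lambda>u y. A u *v y) s t \<zeta> z"
  shows "solves_on (\<lambda>u y. A u *v y) s t (\<eta> + \<zeta>) (\<lambda>u. y u + z u)"
  using assms unfolding solves_on_def
  by (simp add: matrix_vector_right_distrib has_vector_derivative_add)

lemma solves_on_linear_scaleR:
  fixes A :: "real \<Rightarrow> real ^ 'd ^ 'd"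
  assumes "solves_on (\<lambda>u y. A u *v y) s t \<eta> y"
  shows "solves_on (\<lambda>u y. A u *v y) s t (c *\<^sub>R \<eta>) (\<lambda>u. c *\<^sub>R y u)"
  using assms unfolding solves_on_def
  by (simp add: matrix_vector_mult_scaleR
      bounded_linear.has_vector_derivative[OF bounded_linear_scaleR_right])

text \<open>The difference of two solutions with the same initial value solves the equation from 0,
  so all solutions share the end value \<open>y t\<close>.\<close>

lemma flow_linear_eq:
  fixes A :: "real \<Rightarrow> real ^ 'd ^ 'd"
  assumes cont: "continuous_on {s..t} A" and st: "s \<le> t"
    and sol: "solves_on (\<lambda>u y. A u *v y) s t \<eta> y"
  shows "flow (\<lambda>u y. A u *v y) t s \<eta> = y t"
  unfolding flow_def
proof (rule the_equality)
  fix x assume "\<exists>z. solves_on (\<lambda>u y. A u *v y) s t \<eta> z \<and> z t = x"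
  then obtain z where z: "solves_on (\<lambda>u y. A u *v y) s t \<eta> z" "z t = x"
    by (elim exE conjE)
  have "solves_on (\<lambda>u y. A u *v y) s t 0 (\<lambda>u. z u + (- 1) *\<^sub>R y u)"
    using solves_on_linear_add[OF z(1) solves_on_linear_scaleR[OF sol, of "- 1"]] by simp
  from solves_on_linear_zero[OF cont st this] show "x = y t"
    using z(2) by simp
qed (rule exI[of _ y], simp add: sol)

text \<open>Superposition: existence supplies solutions for the summands, and uniqueness identifies
  the end value of their combination with the flow.\<close>

lemma linear_flow:
  fixes A :: "real \<Rightarrow> real ^ 'd ^ 'd"
  assumes cont: "continuous_on {s..t} A" and st: "s \<le> t"
  shows "linear (flow (\<lambda>u y. A u *v y) t s)"
proof (rule linearI)
  note eq = flow_linear_eq[OF cont st] and ex = solves_on_linear_exists[OF cont st]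
  show "flow (\<lambda>u y. A u *v y) t s (\<eta> + \<zeta>) =
      flow (\<lambda>u y. A u *v y) t s \<eta> + flow (\<lambda>u y. A u *v y) t s \<zeta>" for \<eta> \<zeta>
  proof -
    obtain y z where yz: "solves_on (\<lambda>u y. A u *v y) s t \<eta> y"
        "solves_on (\<lambda>u y. A u *v y) s t \<zeta> z"
      using ex by metis
    show ?thesis
      by (simp only: eq[OF yz(1)] eq[OF yz(2)] eq[OF solves_on_linear_add[OF yz]])
  qed
  show "flow (\<lambda>u y. A u *v y) t s (c *\<^sub>R \<eta>) = c *\<^sub>R flow (\<lambda>u y. A u *v y) t s \<eta>" for c \<eta>
  proof -
    obtain y where y: "solves_on (\<lambda>u y. A u *v y) s t \<eta> y"
      using ex by metis
    show ?thesis
      by (simp only: eq[OF y] eq[OF solves_on_linear_scaleR[OF y]])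
  qed
qed

lemma solves_on_mono:
  assumes "solves_on F s t \<eta> y" "s \<le> r" "r \<le> t"
  shows "solves_on F s r \<eta> y" "solves_on F r t (y r) y"
  using assms unfolding solves_on_def
  by (auto intro: has_vector_derivative_within_subset[where S = "{s..t}"])

lemma flow_linear_self: "flow (\<lambda>u y. A u *v y) s s \<eta> = (\<eta> :: real ^ 'd)"
proof -
  \<comment> \<open>Within a one-point interval every bounded linear map is a derivative, so the
    constant function is a solution.\<close>
  have "solves_on (\<lambda>u y. A u *v y) s s \<eta> (\<lambda>_. \<eta>)"
    by (simp add: solves_on_def has_vector_derivative_def has_derivative_within_singleton_iff
        bounded_linear_scaleR_left)
  then show ?thesis
    by (subst flow_linear_eq) auto
qed

text \<open>The cocycle law: a single solution on \<open>{s..t}\<close> restricts to solutions on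
  both pieces, and uniqueness evaluates all three flows along it.\<close>

lemma flow_linear_flow:
  fixes A :: "real \<Rightarrow> real ^ 'd ^ 'd"
  assumes cont: "continuous_on {s..t} A" and "s \<le> r" "r \<le> t"
  shows "flow (\<lambda>u y. A u *v y) t r (flow (\<lambda>u y. A u *v y) r s \<eta>) = flow (\<lambda>u y. A u *v y) t s \<eta>"
proof -
  obtain y where y: "solves_on (\<lambda>u y. A u *v y) s t \<eta> y"
    using solves_on_linear_exists[OF cont] assms by fastforce
  have "continuous_on {s..r} A" "continuous_on {r..t} A"
    using assms by (auto intro: continuous_on_subset[OF cont])
  then show ?thesis
    using assms y solves_on_mono[OF y assms(2,3)] by (auto simp: flow_linear_eq)
qed

text \<open>Stability for \<epsilon> = 1 controls a ball of radius \<delta> uniformly in the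
  starting time; linearity scales this to all initial values.\<close>

lemma uniformly_stable_linear_bound:
  fixes A :: "real \<Rightarrow> real ^ 'd ^ 'd"
  assumes cont: "continuous_on {0..} A" and stable: "uniformly_stable (\<lambda>u y. A u *v y)"
  obtains M where "M > 0"
    "\<And>s t \<eta>. \<lbrakk>0 \<le> s; s \<le> t\<rbrakk> \<Longrightarrow> norm (flow (\<lambda>u y. A u *v y) t s \<eta>) \<le> M * norm \<eta>"
proof -
  obtain \<delta> where \<delta>: "\<delta> > 0" "\<And>\<tau> \<eta> t. \<lbrakk>0 \<le> \<tau>; norm \<eta> < \<delta>; \<tau> \<le> t\<rbrakk> \<Longrightarrow>
      norm (flow (\<lambda>u y. A u *v y) t \<tau> \<eta>) < 1"
    using stable unfolding uniformly_stable_def by (meson zero_less_one)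
  show ?thesis
  proof (rule that[of "2 / \<delta>"])
    fix s t :: real and \<eta> :: "real ^ 'd" assume st: "0 \<le> s" "s \<le> t"
    have "continuous_on {s..t} A"
      by (rule continuous_on_subset[OF cont]) (use st in auto)
    then interpret linear "flow (\<lambda>u y. A u *v y) t s"
      using linear_flow st by blast
    show "norm (flow (\<lambda>u y. A u *v y) t s \<eta>) \<le> 2 / \<delta> * norm \<eta>"
    proof (cases "\<eta> = 0")
      case False
      \<comment> \<open>This rescales \<eta> to norm \<delta>/2, strictly inside the ball; hence the
        constant \<open>2 / \<delta>\<close>.\<close>
      define c where "c = \<delta> / (2 * norm \<eta>)"
      have "c > 0" and "norm (c *\<^sub>R \<eta>) < \<delta>"
        using False \<delta>(1) by (auto simp: c_def)
      then have "c * norm (flow (\<lambda>u y. A u *v y) t s \<eta>) < 1"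
        using \<delta>(2)[OF st(1) _ st(2), of "c *\<^sub>R \<eta>"] by (simp add: scale)
      then show ?thesis
        using False \<delta>(1) by (simp add: c_def field_simps)
    qed simp
  qed (use \<delta>(1) in simp)
qed

section \<open>Error growth\<close>

text \<open>Every kick is carried directly to the final time, so \<open>M\<close> enters once per
  kick and its powers do not accumulate from step to step.\<close>

lemma norm_approximation_le:
  fixes A :: "real \<Rightarrow> real ^ 'd ^ 'd"
  assumes cont: "continuous_on {0..} A"
    and M: "M \<ge> 0"
      "\<And>s t \<eta>. \<lbrakk>0 \<le> s; s \<le> t\<rbrakk> \<Longrightarrow> norm (flow (\<lambda>u y. A u *v y) t s \<eta>) \<le> M * norm \<eta>"
    and h: "h > 0" "\<alpha> h \<ge> 0"
    and z: "z \<in> approximations (\<lambda>u y. A u *v y) \<alpha> h"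
    and t: "t \<ge> 0"
  shows "norm (z t) \<le> M * t * \<alpha> h"
proof -
  let ?\<Phi> = "flow (\<lambda>u y. A u *v y)"
  obtain v where v: "\<And>n. n \<ge> 1 \<Longrightarrow> norm (v n) \<le> 1"
    and z0: "z 0 = 0"
    and grid: "\<And>n. n \<ge> 1 \<Longrightarrow> z (real n * h) =
       ?\<Phi> (real n * h) ((real n - 1) * h) (z ((real n - 1) * h)) + (h * \<alpha> h) *\<^sub>R v n"
    and mid: "\<And>n t. \<lbrakk>n \<ge> 1; (real n - 1) * h \<le> t; t < real n * h\<rbrakk> \<Longrightarrow>
       z t = ?\<Phi> t ((real n - 1) * h) (z ((real n - 1) * h))"
    using z unfolding approximations_def by blast
  have lin: "linear (?\<Phi> t s)" if "0 \<le> s" "s \<le> t" for s t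
    using that by (intro linear_flow continuous_on_subset[OF cont]) auto
  \<comment> \<open>The induction runs over the grid value transported to a fixed time
    \<open>t\<close>, not over the grid value itself.\<close>
  have bound: "norm (?\<Phi> t (real n * h) (z (real n * h))) \<le> M * (real n * h) * \<alpha> h"
    if "real n * h \<le> t" for n t
    using that
  proof (induction n)
    case 0
    then show ?case
      using linear_0[OF lin[of 0 t]] z0 by simp
  next
    case (Suc n)
    let ?a = "real n * h" and ?b = "real (Suc n) * h"
    have ab: "0 \<le> ?a" "?a \<le> ?b" "?b \<le> t" "0 \<le> ?b"
      using h Suc.prems by (auto simp: algebra_simps)
    have "z ?b = ?\<Phi> ?b ?a (z ?a) + (h * \<alpha> h) *\<^sub>R v (Suc n)"
      using grid[of "Suc n"] by simp
    \<comment> \<open>By linearity and the cocycle law the old part is again transported from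
      \<open>?a\<close> to the same \<open>t\<close>, where the induction hypothesis applies; only
      one new kick is added.\<close>
    then have "?\<Phi> t ?b (z ?b) = ?\<Phi> t ?a (z ?a) + (h * \<alpha> h) *\<^sub>R ?\<Phi> t ?b (v (Suc n))"
      using linear_add[OF lin] linear_scale[OF lin] ab
        flow_linear_flow[OF continuous_on_subset[OF cont], of ?a t ?b]
      by (simp add: subset_iff)
    moreover have "norm (?\<Phi> t ?a (z ?a)) \<le> M * ?a * \<alpha> h"
      using ab by (intro Suc.IH) linarith
    moreover have "norm (?\<Phi> t ?b (v (Suc n))) \<le> M"
      using M(2)[OF ab(4,3), of "v (Suc n)"] mult_left_mono[OF v[of "Suc n"] M(1)] by simp
    then have "norm ((h * \<alpha> h) *\<^sub>R ?\<Phi> t ?b (v (Suc n))) \<le> h * \<alpha> h * M"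
      using h by (simp add: mult_left_mono)
    ultimately have "norm (?\<Phi> t ?b (z ?b)) \<le> M * ?a * \<alpha> h + h * \<alpha> h * M"
      by (metis add_mono norm_triangle_le)
    then show ?case
      by (simp add: algebra_simps)
  qed
  \<comment> \<open>The last grid point not after \<open>t\<close> has index \<open>n\<close>. The
    interval containing \<open>t\<close> is numbered by its right end, so \<open>mid\<close> is used
    at \<open>Suc n\<close>.\<close>
  define n where "n = nat \<lfloor>t / h\<rfloor>"
  have "real n \<le> t / h" "t / h < real n + 1"
    using t h by (auto simp: n_def intro: divide_nonneg_pos)
  then have n: "real n * h \<le> t" "t < real (Suc n) * h"
    using h by (auto simp: field_simps)
  then have "norm (z t) \<le> M * (real n * h) * \<alpha> h"
    using mid[of "Suc n" t] bound[OF n(1)] by simp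
  also have "\<dots> \<le> M * t * \<alpha> h"
    using n M h by (intro mult_right_mono mult_left_mono) auto
  finally show ?thesis .
qed

theorem theorem5p5:
  fixes A :: "real \<Rightarrow> real ^ 'd ^ 'd"
  assumes "continuous_on {0..} A"
    and "uniformly_stable (\<lambda>t y. A t *v y)"
  shows "\<exists>K>0. \<forall>\<alpha>. gauge_fun \<alpha> \<longrightarrow>
           (\<forall>t\<ge>0. error_growth (\<lambda>t y. A t *v y) \<alpha> t \<le> ereal (K * t))"
proof -
  \<comment> \<open>\<open>M\<close> is fixed before any \<alpha> is chosen, so it serves as
    \<open>K\<close> for all gauges at once.\<close>
  obtain M where M: "M > 0" "\<And>s t \<eta>. \<lbrakk>0 \<le> s; s \<le> t\<rbrakk> \<Longrightarrow>
      norm (flow (\<lambda>u y. A u *v y) t s \<eta>) \<le> M * norm \<eta>"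
    using uniformly_stable_linear_bound[OF assms] by metis
  have "error_growth (\<lambda>t y. A t *v y) \<alpha> t \<le> ereal (M * t)"
    if \<alpha>: "gauge_fun \<alpha>" and t: "t \<ge> 0" for \<alpha> t
    unfolding error_growth_def
  proof (rule Limsup_bounded)
    \<comment> \<open>The quotient is bounded for every positive \<open>h\<close>, not only in the
      limit; positivity of \<open>\<alpha> h\<close> makes the extended-real division
      cancel.\<close>
    have "max_error (\<lambda>t y. A t *v y) \<alpha> t h / ereal (\<alpha> h) \<le> ereal (M * t)" if h: "h > 0" for h
    proof -
      have \<alpha>h: "\<alpha> h > 0"
        using \<alpha> h strict_mono_onD[of "{0..}" \<alpha> 0 h] by (simp add: gauge_fun_def)
      have "max_error (\<lambda>t y. A t *v y) \<alpha> t h \<le> ereal (M * t * \<alpha> h)"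
        unfolding max_error_def
        using norm_approximation_le[where \<alpha> = \<alpha>, OF assms(1) less_imp_le[OF M(1)] M(2) h less_imp_le[OF \<alpha>h] _ t]
        by (intro SUP_least) simp
      then have "max_error (\<lambda>t y. A t *v y) \<alpha> t h / ereal (\<alpha> h) \<le> ereal (M * t * \<alpha> h) / ereal (\<alpha> h)"
        using \<alpha>h by (intro ereal_divide_right_mono) auto
      then show ?thesis
        using \<alpha>h by simp
    qed
    then show "\<forall>\<^sub>F h in at_right 0.
        max_error (\<lambda>t y. A t *v y) \<alpha> t h / ereal (\<alpha> h) \<le> ereal (M * t)"
      by (auto simp: eventually_at_right_less intro: eventually_mono[OF eventually_at_right_less])
  qed
  then show ?thesis
    using M(1) by blast
qed

end
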